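(* Let $(\Omega,\mathcal F)$ be a measurable space, $\mathcal G\subseteq\mathcal F$ a sub-$\sigma$-algebra, and let $c:\mathcal F\to[0,1]$ be a capacity which is continuous from below. Assume that there exists a real-valued $\mathcal F$-measurable function $Z$ whose distribution function $G_Z$ with respect to $c$ is continuous and satisfies $\lim_{x\to-\infty}G_Z(x)=0$ and $\lim_{x\to+\infty}G_Z(x)=1$. Let $\rho:\chi(\mathcal F)\to\chi(\mathcal G)$ be an operator (conditional risk measure) satisfying, for all $X,Y\in\chi(\mathcal F)$: (i) if $X\preceq_{sl,c}Y$, then $\rho(X)\le\rho(Y)$; (ii) if $X$ and $Y$ are comonotonic, then $\rho(X+Y)=\rho(X)+\rho(Y)$; (iii) for every $a\in\mathbb R$, $\rho(X+a)=\rho(X)+a$; (iv) for every real $a\ge0$, $\rho(aX)=a\rho(X)$. Then there exists a concave $\mathcal G$-random distortion function $\phi^{\mathcal G}$ such that $$\rho(X)=\mathbb E_{\phi^{\mathcal G}\circ c}(X)\quad\text{for all }X\in\chi(\mathcal F).$$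
   Context: $\chi(\mathcal F)$ (resp. $\chi(\mathcal G)$) is the set of all bounded real-valued $\mathcal F$-measurable (resp. $\mathcal G$-measurable) functions on $\Omega$. Equalities and inequalities between functions are pointwise for all $\omega\in\Omega$. A ($\mathcal G$-)conditional risk measure is any operator $\rho:\chi(\mathcal F)\to\chi(\mathcal G)$. A capacity on $(\Omega,\mathcal F)$ is a set function $c:\mathcal F\to[0,1]$ with $c(\emptyset)=0$, $c(\Omega)=1$, and $c(A)\le c(B)$ whenever $A\subset B$, $A,B\in\mathcal F$. It is continuous from below if $\lim_n c(A_n)=c(\bigcup_n A_n)$ for every sequence $(A_n)$ in $\mathcal F$ with $A_n\subset A_{n+1}$ for all $n$. The distribution function of a real-valued measurable $X$ with respect to $c$ is $G_X(x):=1-c(X>x)$, $x\in\mathbb R$. The Choquet integral of $X\in\chi(\mathcal F)$ with respect to $c$ is $\mathbb E_c(X)=\int_0^{+\infty}c(X>x)\,dx+\int_{-\infty}^0[c(X>x)-1]\,dx$. Stop-loss ordering with respect to $c$: $X\preceq_{sl,c}Y$ means $\mathbb E_c((X-b)^+)\le\mathbb E_c((Y-b)^+)$ for all $b\in\mathbb R$. $X$ and $Y$ are comonotonic if $(X(\omega)-X(\bar\omega))(Y(\omega)-Y(\bar\omega))\ge0$ for all $(\omega,\bar\omega)\in\Omega\times\Omega$. A $\mathcal G$-random distortion function is a map $\phi^{\mathcal G}:\Omega\times[0,1]\to[0,1]$ such that for every $\omega\in\Omega$ the function $t\mapsto\phi^{\mathcal G}(\omega,t)$ is non-decreasing with $\phi^{\mathcal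 G}(\omega,0)=0$, $\phi^{\mathcal G}(\omega,1)=1$, and for every $t\in[0,1]$ the function $\omega\mapsto\phi^{\mathcal G}(\omega,t)$ is $\mathcal G$-measurable. It is called concave if for all $\omega\in\Omega$ the function $t\mapsto\phi^{\mathcal G}(\omega,t)$ is concave. The $\mathcal G$-randomly distorted Choquet integral of $X\in\chi(\mathcal F)$ is defined, for all $\omega\in\Omega$, by $$\mathbb E_{\phi^{\mathcal G}\circ c}(X)(\omega)=\int_0^{+\infty}\phi^{\mathcal G}(\omega,c(X>x))\,dx+\int_{-\infty}^0[\phi^{\mathcal G}(\omega,c(X>x))-1]\,dx.$$ *)

theory Defs
  imports "HOL-Probability.Probability"
begin

text \<open>
  A measurable space is an element of type \<open>'a measure\<close> of which only \<open>space\<close> and \<open>sets\<close> are used;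
  the measure it carries is irrelevant throughout. Random variables are total functions on \<open>'a\<close>
  whose values outside the space are immaterial: all (in)equalities below range over the space.
\<close>

definition bdd_measurable :: "'a measure \<Rightarrow> ('a \<Rightarrow> real) set"
  where "bdd_measurable M = {X \<in> borel_measurable M. bounded (X ` space M)}"

definition capacity :: "'a measure \<Rightarrow> ('a set \<Rightarrow> real) \<Rightarrow> bool"
  where "capacity M c \<longleftrightarrow>
    c \<in> sets M \<rightarrow> {0..1} \<and> c {} = 0 \<and> c (space M) = 1 \<and>
    (\<forall>A\<in>sets M. \<forall>B\<in>sets M. A \<subseteq> B \<longrightarrow> c A \<le> c B)"

definition continuous_from_below :: "'a measure \<Rightarrow> ('a set \<Rightarrow> real) \<Rightarrow> bool"
  where "continuous_from_below M c \<longleftrightarrow>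
    (\<forall>A :: nat \<Rightarrow> 'a set. range A \<subseteq> sets M \<longrightarrow> (\<forall>n. A n \<subseteq> A (Suc n)) \<longrightarrow>
      (\<lambda>n. c (A n)) \<longlonglongrightarrow> c (\<Union>n. A n))"

definition distr_fun :: "'a measure \<Rightarrow> ('a set \<Rightarrow> real) \<Rightarrow> ('a \<Rightarrow> real) \<Rightarrow> real \<Rightarrow> real"
  where "distr_fun M c X x = 1 - c {\<omega>\<in>space M. X \<omega> > x}"

text \<open>
  For a monotone set function and bounded \<open>X\<close> both integrands are monotone in \<open>x\<close>, bounded and
  vanish off a bounded set, so the Lebesgue integrals exist and equal the (improper) Riemann ones.
\<close>

definition choquet_integral :: "'a measure \<Rightarrow> ('a set \<Rightarrow> real) \<Rightarrow> ('a \<Rightarrow> real) \<Rightarrow> real"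
  where "choquet_integral M c X =
    (LBINT x:{0..}. c {\<omega>\<in>space M. X \<omega> > x}) +
    (LBINT x:{..0}. c {\<omega>\<in>space M. X \<omega> > x} - 1)"

definition stop_loss_le ::
    "'a measure \<Rightarrow> ('a set \<Rightarrow> real) \<Rightarrow> ('a \<Rightarrow> real) \<Rightarrow> ('a \<Rightarrow> real) \<Rightarrow> bool"
  where "stop_loss_le M c X Y \<longleftrightarrow>
    (\<forall>b. choquet_integral M c (\<lambda>\<omega>. max (X \<omega> - b) 0)
       \<le> choquet_integral M c (\<lambda>\<omega>. max (Y \<omega> - b) 0))"

definition comonotonic :: "'a measure \<Rightarrow> ('a \<Rightarrow> real) \<Rightarrow> ('a \<Rightarrow> real) \<Rightarrow> bool"
  where "comonotonic M X Y \<longleftrightarrow>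
    (\<forall>\<omega>\<in>space M. \<forall>\<omega>'\<in>space M. (X \<omega> - X \<omega>') * (Y \<omega> - Y \<omega>') \<ge> 0)"

definition random_distortion :: "'a measure \<Rightarrow> ('a \<Rightarrow> real \<Rightarrow> real) \<Rightarrow> bool"
  where "random_distortion G \<phi> \<longleftrightarrow>
    (\<forall>\<omega>\<in>space G. \<phi> \<omega> \<in> {0..1} \<rightarrow> {0..1} \<and> mono_on {0..1} (\<phi> \<omega>) \<and>
      \<phi> \<omega> 0 = 0 \<and> \<phi> \<omega> 1 = 1) \<and>
    (\<forall>t\<in>{0..1}. (\<lambda>\<omega>. \<phi> \<omega> t) \<in> borel_measurable G)"

definition concave_random_distortion :: "'a measure \<Rightarrow> ('a \<Rightarrow> real \<Rightarrow> real) \<Rightarrow> bool"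
  where "concave_random_distortion G \<phi> \<longleftrightarrow>
    random_distortion G \<phi> \<and> (\<forall>\<omega>\<in>space G. concave_on {0..1} (\<phi> \<omega>))"

definition distorted_choquet_integral ::
    "'a measure \<Rightarrow> ('a \<Rightarrow> real \<Rightarrow> real) \<Rightarrow> ('a set \<Rightarrow> real) \<Rightarrow> ('a \<Rightarrow> real) \<Rightarrow> 'a \<Rightarrow> real"
  where "distorted_choquet_integral M \<phi> c X \<omega> =
    (LBINT x:{0..}. \<phi> \<omega> (c {\<omega>'\<in>space M. X \<omega>' > x})) +
    (LBINT x:{..0}. \<phi> \<omega> (c {\<omega>'\<in>space M. X \<omega>' > x}) - 1)"

end

theory Submission
  imports Defs
begin

text \<open>
  Fix \<open>\<omega>\<close>. Stop-loss monotonicity makes \<open>\<rho> 1\<^sub>A \<omega>\<close> a nondecreasing function \<open>\<phi> \<omega>\<close> of \<open>c A\<close>, and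
  the upper level sets of \<open>Z\<close> form a chain on which \<open>c\<close> attains every value in \<open>[0, 1]\<close>.
  If \<open>S \<subseteq> U\<close> and \<open>c A = l * c U + (1 - l) * c S\<close>, then \<open>l 1\<^sub>U + (1 - l) 1\<^sub>S\<close> precedes \<open>1\<^sub>A\<close> in the
  stop-loss order, so comonotonic additivity makes \<open>\<phi> \<omega>\<close> concave. Finally
  \<open>F a = \<rho> (min X a) \<omega>\<close> satisfies \<open>(b - a) g b \<le> F b - F a \<le> (b - a) g a\<close> with
  \<open>g x = \<phi> \<omega> (c (X > x))\<close>, and so does any antiderivative of \<open>g\<close>; for antitone \<open>g\<close> these bounds
  determine the increments of \<open>F\<close>.
\<close>

section \<open>Antitone functions on the real line\<close>

lemma borel_measurable_antimono:
  fixes g :: "real \<Rightarrow> real"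
  assumes "antimono g"
  shows "g \<in> borel_measurable borel"
proof -
  have "mono (\<lambda>x. - g x)"
    using assms by (auto simp: mono_def antimono_def)
  then have "(\<lambda>x. - g x) \<in> borel_measurable borel"
    by (rule borel_measurable_mono)
  then show ?thesis by simp
qed

lemma set_integrable_antimono_Icc:
  fixes g :: "real \<Rightarrow> real"
  assumes "antimono g"
  shows "set_integrable lborel {a..b} g"
  unfolding set_integrable_def
proof (rule Bochner_Integration.integrable_bound)
  show "integrable lborel (\<lambda>x. indicat_real {a..b} x * (\<bar>g a\<bar> + \<bar>g b\<bar>))"
    by (intro integrable_mult_left integrable_real_indicator) (auto simp: emeasure_lborel_Icc_eq)
  show "AE x in lborel. norm (indicat_real {a..b} x *\<^sub>R g x)
      \<le> norm (indicat_real {a..b} x * (\<bar>g a\<bar> + \<bar>g b\<bar>))"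
  proof (rule AE_I2)
    fix x
    show "norm (indicat_real {a..b} x *\<^sub>R g x)
      \<le> norm (indicat_real {a..b} x * (\<bar>g a\<bar> + \<bar>g b\<bar>))"
      using antimonoD[OF assms, of a x] antimonoD[OF assms, of x b] by (auto simp: indicator_def)
  qed
qed (use borel_measurable_antimono[OF assms] in auto)

lemma set_integrable_antimono_vanishing:
  fixes g :: "real \<Rightarrow> real"
  assumes "antimono g" and "\<And>x. x \<ge> K \<Longrightarrow> g x = 0"
  shows "set_integrable lborel {a..} g"
proof -
  have "set_integrable lborel {a..K} g"
    by (rule set_integrable_antimono_Icc[OF assms(1)])
  moreover have "(\<lambda>x. indicat_real {a..} x *\<^sub>R g x) = (\<lambda>x. indicat_real {a..K} x *\<^sub>R g x)"
    using assms(2) by (auto simp: fun_eq_iff indicator_def)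
  ultimately show ?thesis
    by (simp only: set_integrable_def)
qed

text \<open>Cut \<open>{a..b}\<close> into \<open>Suc n\<close> equal steps. On a step from x to y
  the increment of \<open>F\<close> exceeds that of \<open>I\<close> by at most the step length
  times \<open>g x - g y\<close>. These errors telescope to
  \<open>(b - a) * (g a - g b) / real (Suc n)\<close>, which tends to 0.\<close>

lemma increments_le_of_sandwich:
  fixes F I g :: "real \<Rightarrow> real"
  assumes "a \<le> b"
    and F: "\<And>x y. a \<le> x \<Longrightarrow> x \<le> y \<Longrightarrow> F y - F x \<le> (y - x) * g x"
    and I: "\<And>x y. a \<le> x \<Longrightarrow> x \<le> y \<Longrightarrow> (y - x) * g y \<le> I y - I x"
  shows "F b - F a \<le> I b - I a"
proof -
  have bound: "F b - F a - (I b - I a) \<le> (b - a) * (g a - g b) / real (Suc n)" for n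
  proof -
    define d where "d = (b - a) / real (Suc n)"
    have d: "d \<ge> 0" using \<open>a \<le> b\<close> by (simp add: d_def)
    \<comment> \<open>The telescoped error after \<open>i\<close> steps; the last partition point,
      \<open>i = Suc n\<close>, is \<open>b\<close>.\<close>
    have "F (a + real i * d) - F a - (I (a + real i * d) - I a)
        \<le> d * (g a - g (a + real i * d))" for i
    proof (induction i)
      case 0
      show ?case by simp
    next
      case (Suc i)
      let ?x = "a + real i * d" and ?y = "a + real (Suc i) * d"
      have xy: "a \<le> ?x" "?x \<le> ?y" "?y - ?x = d"
        using d by (auto simp: algebra_simps)
      show ?case
        using Suc F[OF xy(1,2)] I[OF xy(1,2)] unfolding xy(3) right_diff_distrib by linarith
    qed
    from this[of "Suc n"] show ?thesis by (simp add: d_def)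
  qed
  have "(\<lambda>n. (b - a) * (g a - g b) / real (Suc n)) \<longlonglongrightarrow> 0"
    by (intro LIMSEQ_Suc tendsto_divide_0[OF tendsto_const] filterlim_real_sequentially
        filterlim_at_top_imp_at_infinity)
  then have "F b - F a - (I b - I a) \<le> 0"
    by (rule LIMSEQ_le_const) (use bound in blast)
  then show ?thesis by simp
qed

lemma set_integral_antimono_bounds:
  fixes g :: "real \<Rightarrow> real"
  assumes g: "antimono g" and "k \<le> a" "a \<le> b"
  shows "(LBINT x:{k..b}. g x) - (LBINT x:{k..a}. g x) \<le> (b - a) * g a"
    and "(b - a) * g b \<le> (LBINT x:{k..b}. g x) - (LBINT x:{k..a}. g x)"
proof -
  have int: "set_integrable lborel {a<..b} g"
    using set_integrable_antimono_Icc[OF g, of a b] by (rule set_integrable_subset) auto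
  have "(LBINT x:{k..a} \<union> {a<..b}. g x) = (LBINT x:{k..a}. g x) + (LBINT x:{a<..b}. g x)"
    by (intro set_integral_Un int set_integrable_antimono_Icc[OF g]) auto
  moreover have "{k..a} \<union> {a<..b} = {k..b}" using assms by auto
  ultimately have eq: "(LBINT x:{k..b}. g x) - (LBINT x:{k..a}. g x) = (LBINT x:{a<..b}. g x)"
    by simp
  have const: "set_integrable lborel {a<..b} (\<lambda>_. r)" "(LBINT x:{a<..b}. r) = (b - a) * r"
    for r :: real
    using \<open>a \<le> b\<close> by (auto simp: set_integrable_def set_lebesgue_integral_def)
  have "(LBINT x:{a<..b}. g x) \<le> (LBINT x:{a<..b}. g a)"
    by (intro set_integral_mono int const antimonoD[OF g]) auto
  then show "(LBINT x:{k..b}. g x) - (LBINT x:{k..a}. g x) \<le> (b - a) * g a"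
    unfolding eq const .
  have "(LBINT x:{a<..b}. g b) \<le> (LBINT x:{a<..b}. g x)"
    by (intro set_integral_mono int const antimonoD[OF g]) auto
  then show "(b - a) * g b \<le> (LBINT x:{k..b}. g x) - (LBINT x:{k..a}. g x)"
    unfolding eq const .
qed

text \<open>\<open>F\<close> and the integral with variable upper limit obey the same two-sided
  bounds in terms of \<open>g\<close>. Comparing them in both directions identifies \<open>F\<close>
  without any differentiation.\<close>

lemma increment_eq_set_integral:
  fixes F g :: "real \<Rightarrow> real"
  assumes g: "antimono g" and "a \<le> b"
    and upper: "\<And>x y. x \<le> y \<Longrightarrow> F y - F x \<le> (y - x) * g x"
    and lower: "\<And>x y. x \<le> y \<Longrightarrow> (y - x) * g y \<le> F y - F x"
  shows "F b - F a = (LBINT x:{a..b}. g x)"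
proof -
  define I where "I = (\<lambda>y. LBINT x:{a..y}. g x)"
  have "AE x in lborel. x \<noteq> a" by (rule AE_lborel_singleton)
  then have "I a = 0"
    unfolding I_def set_lebesgue_integral_def
    by (intro integral_eq_zero_AE, eventually_elim) (simp add: indicator_def)
  moreover have "F b - F a \<le> I b - I a"
    by (rule increments_le_of_sandwich[where g = g, OF \<open>a \<le> b\<close> upper])
      (auto simp: I_def intro: set_integral_antimono_bounds[OF g])
  moreover have "I b - I a \<le> F b - F a"
    by (rule increments_le_of_sandwich[where g = g, OF \<open>a \<le> b\<close> _ lower])
      (auto simp: I_def intro: set_integral_antimono_bounds[OF g])
  ultimately show ?thesis by (simp add: I_def)
qed

text \<open>Brings the two-sided Choquet form to a compact interval: both integrands vanish off
  \<open>{-K..K}\<close>, and the subtracted 1 contributes the length of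
  \<open>{-K..0}\<close>.\<close>

lemma set_integral_halflines_antimono:
  fixes g :: "real \<Rightarrow> real"
  assumes g: "antimono g" and "K \<ge> 0"
    and hi: "\<And>x. x \<ge> K \<Longrightarrow> g x = 0" and lo: "\<And>x. x < - K \<Longrightarrow> g x = 1"
  shows "(LBINT x:{0..}. g x) + (LBINT x:{..0}. g x - 1) = (LBINT x:{-K..K}. g x) - K"
proof -
  \<comment> \<open>Dropping the null point 0 makes this interval disjoint from
    \<open>{-K..0}\<close>, so that the two integrals can be glued.\<close>
  have "(LBINT x:{0..}. g x) = (LBINT x:{0<..K}. g x)"
    unfolding set_lebesgue_integral_def
  proof (rule integral_cong_AE)
    have "AE x in lborel. x \<noteq> (0::real)" by (rule AE_lborel_singleton)
    then show "AE x in lborel. indicat_real {0..} x *\<^sub>R g x = indicat_real {0<..K} x *\<^sub>R g x"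
      by eventually_elim (use hi in \<open>auto simp: indicator_def\<close>)
  qed (use borel_measurable_antimono[OF g] in auto)
  moreover have "(LBINT x:{..0}. g x - 1) = (LBINT x:{-K..0}. g x - 1)"
    unfolding set_lebesgue_integral_def
    by (intro Bochner_Integration.integral_cong refl) (use lo in \<open>auto simp: indicator_def\<close>)
  moreover have "(LBINT x:{-K..0}. g x - 1) = (LBINT x:{-K..0}. g x) - (LBINT x:{-K..0}. 1)"
    by (intro set_integral_diff set_integrable_antimono_Icc[OF g])
      (auto simp: set_integrable_def emeasure_lborel_Icc_eq intro!: integrable_real_indicator)
  moreover have "(LBINT x:{-K..0}. 1) = K"
    using \<open>K \<ge> 0\<close> by (simp add: set_lebesgue_integral_def)
  moreover have "(LBINT x:{-K..0} \<union> {0<..K}. g x) = (LBINT x:{-K..0}. g x) + (LBINT x:{0<..K}. g x)"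
    by (intro set_integral_Un set_integrable_antimono_Icc[OF g]
        set_integrable_subset[OF set_integrable_antimono_Icc[OF g, of 0 K]]) auto
  moreover have "{-K..0} \<union> {0<..K} = {-K..K}" using \<open>K \<ge> 0\<close> by auto
  ultimately show ?thesis by simp
qed

section \<open>Capacities and the stop-loss order\<close>

lemma bdd_measurableI:
  assumes "X \<in> borel_measurable M" and "\<And>\<omega>. \<omega> \<in> space M \<Longrightarrow> \<bar>X \<omega>\<bar> \<le> K"
  shows "X \<in> bdd_measurable M"
  using assms by (auto simp: bdd_measurable_def bounded_iff)

lemma bdd_measurableE:
  assumes "X \<in> bdd_measurable M"
  obtains K where "X \<in> borel_measurable M" "K > 0" "\<And>\<omega>. \<omega> \<in> space M \<Longrightarrow> \<bar>X \<omega>\<bar> < K"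
proof -
  from assms obtain B where "X \<in> borel_measurable M" "\<forall>\<omega>\<in>space M. \<bar>X \<omega>\<bar> \<le> B"
    by (auto simp: bdd_measurable_def bounded_iff)
  then show ?thesis
    by (intro that[of "\<bar>B\<bar> + 1"]) (auto intro: le_less_trans)
qed

text \<open>Both differences have the sign of the difference of \<open>X\<close>. This is applied to
  the layers of a single random variable.\<close>

lemma comonotonic_compose:
  assumes "mono f" "mono g"
  shows "comonotonic M (\<lambda>\<omega>. f (X \<omega>)) (\<lambda>\<omega>. g (X \<omega> :: real))"
  unfolding comonotonic_def
proof (intro ballI)
  fix \<omega> \<omega>'
  show "0 \<le> (f (X \<omega>) - f (X \<omega>')) * (g (X \<omega>) - g (X \<omega>'))"
    using monoD[OF assms(1)] monoD[OF assms(2)] linear[of "X \<omega>" "X \<omega>'"]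
    by (auto simp: zero_le_mult_iff)
qed

lemma capacity_le:
  assumes "capacity M c" "A \<in> sets M" "B \<in> sets M" "A \<subseteq> B"
  shows "c A \<le> c B"
  using assms by (auto simp: capacity_def)

lemma capacity_bounds:
  assumes "capacity M c" "A \<in> sets M"
  shows "0 \<le> c A" "c A \<le> 1"
  using assms by (auto simp: capacity_def)

lemma capacity_greater_antimono:
  fixes X :: "'a \<Rightarrow> real"
  assumes "capacity M c" "X \<in> borel_measurable M"
  shows "antimono (\<lambda>x. c {\<omega>\<in>space M. X \<omega> > x})"
proof -
  have "{\<omega>\<in>space M. X \<omega> > x} \<in> sets M" for x
    using assms(2) by simp
  then show ?thesis by (intro antimonoI capacity_le[OF assms(1)]) auto
qed

lemma capacity_greater_eq_0:
  fixes X :: "'a \<Rightarrow> real"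
  assumes "capacity M c" "\<And>\<omega>. \<omega> \<in> space M \<Longrightarrow> X \<omega> \<le> x"
  shows "c {\<omega>\<in>space M. X \<omega> > x} = 0"
proof -
  have "{\<omega>\<in>space M. X \<omega> > x} = {}" using assms(2) by (auto dest: leD)
  then show ?thesis using assms(1) by (simp only: capacity_def)
qed

lemma capacity_greater_eq_1:
  fixes X :: "'a \<Rightarrow> real"
  assumes "capacity M c" "\<And>\<omega>. \<omega> \<in> space M \<Longrightarrow> X \<omega> > x"
  shows "c {\<omega>\<in>space M. X \<omega> > x} = 1"
proof -
  have "{\<omega>\<in>space M. X \<omega> > x} = space M" using assms(2) by force
  then show ?thesis using assms(1) by (simp add: capacity_def)
qed

text \<open>A positive part exceeds every negative level, so the negative half-line contributes only
  at the null point 0. Stop-loss comparison thereby becomes comparison of tail integrals of survival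
  functions.\<close>

lemma choquet_integral_pos_part:
  assumes "capacity M c"
  shows "choquet_integral M c (\<lambda>\<omega>. max (X \<omega> - b) 0) =
    (LBINT x:{0..}. c {\<omega>\<in>space M. X \<omega> > x + b})"
proof -
  have "AE x in lborel. x \<noteq> (0::real)" by (rule AE_lborel_singleton)
  then have "(LBINT x:{..0}. c {\<omega>\<in>space M. max (X \<omega> - b) 0 > x} - 1) = 0"
    unfolding set_lebesgue_integral_def
    by (intro integral_eq_zero_AE, eventually_elim)
      (auto simp: indicator_def intro!: capacity_greater_eq_1[OF assms])
  moreover have "(LBINT x:{0..}. c {\<omega>\<in>space M. max (X \<omega> - b) 0 > x}) =
      (LBINT x:{0..}. c {\<omega>\<in>space M. X \<omega> > x + b})"
    unfolding set_lebesgue_integral_def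
    by (intro Bochner_Integration.integral_cong refl)
      (auto simp: indicator_def less_max_iff_disj less_diff_eq intro!: arg_cong[where f = c])
  ultimately show ?thesis by (simp add: choquet_integral_def)
qed

lemma stop_loss_le_if_survival_le:
  assumes cap: "capacity M c" and X: "X \<in> bdd_measurable M" and Y: "Y \<in> bdd_measurable M"
    and le: "\<And>x. c {\<omega>\<in>space M. X \<omega> > x} \<le> c {\<omega>\<in>space M. Y \<omega> > x}"
  shows "stop_loss_le M c X Y"
proof -
  have int: "set_integrable lborel {0..} (\<lambda>x. c {\<omega>\<in>space M. W \<omega> > x + b})"
    if "W \<in> bdd_measurable M" for W b
  proof -
    from that obtain K where W: "W \<in> borel_measurable M"
      and K: "\<And>\<omega>. \<omega> \<in> space M \<Longrightarrow> \<bar>W \<omega>\<bar> < K"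
      by (auto elim!: bdd_measurableE)
    show ?thesis
    proof (rule set_integrable_antimono_vanishing)
      show "antimono (\<lambda>x. c {\<omega>\<in>space M. W \<omega> > x + b})"
        using capacity_greater_antimono[OF cap W] by (auto simp: antimono_def)
      show "c {\<omega>\<in>space M. W \<omega> > x + b} = 0" if "x \<ge> K - b" for x
        by (rule capacity_greater_eq_0[OF cap]) (use K that in fastforce)
    qed
  qed
  show ?thesis
    unfolding stop_loss_le_def choquet_integral_pos_part[OF cap]
    by (intro allI set_integral_mono int X Y le)
qed

text \<open>As \<open>x\<close> passes 0, \<open>l\<close> and 1, the level set drops from the whole
  space to \<open>U\<close>, to \<open>S\<close> and to the empty set. The right-hand side is the
  survival function of a law with masses \<open>1 - c U\<close>, \<open>c U - c S\<close> and
  \<open>c S\<close> at 0, \<open>l\<close> and 1.\<close>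

lemma capacity_step_greater:
  fixes l x :: real
  assumes cap: "capacity M c" and S: "S \<in> sets M" and U: "U \<in> sets M" and "S \<subseteq> U"
    and l: "0 \<le> l" "l \<le> 1"
  shows "c {\<omega>\<in>space M. l * indicator U \<omega> + (1 - l) * indicator S \<omega> > x} =
    (1 - c U) * indicator {..<0} x + (c U - c S) * indicator {..<l} x + c S * indicator {..<1} x"
proof -
  have SU: "S \<subseteq> space M" "U \<subseteq> space M" using S U by (auto dest: sets.sets_into_space)
  have c: "c (space M) = 1" using cap by (auto simp: capacity_def)
  consider "x < 0" | "0 \<le> x" "x < l" | "l \<le> x" "x < 1" "0 \<le> x" | "1 \<le> x"
    by linarith
  then show ?thesis
  proof cases
    case 1
    have "{\<omega>\<in>space M. l * indicator U \<omega> + (1 - l) * indicator S \<omega> > x} = space M"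
      using 1 l by (auto simp: indicator_def)
    then show ?thesis using 1 l c by simp
  next
    case 2
    have "{\<omega>\<in>space M. l * indicator U \<omega> + (1 - l) * indicator S \<omega> > x} = U"
      using 2 l SU \<open>S \<subseteq> U\<close> by (auto simp: indicator_def split: if_splits)
    then show ?thesis using 2 l by simp
  next
    case 3
    have "{\<omega>\<in>space M. l * indicator U \<omega> + (1 - l) * indicator S \<omega> > x} = S"
      using 3 l SU \<open>S \<subseteq> U\<close> by (auto simp: indicator_def split: if_splits)
    then show ?thesis using 3 by simp
  next
    case 4
    have "c {\<omega>\<in>space M. l * indicator U \<omega> + (1 - l) * indicator S \<omega> > x} = 0"
      by (rule capacity_greater_eq_0[OF cap]) (use 4 l in \<open>auto simp: indicator_def\<close>)
    then show ?thesis using 4 l by simp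
  qed
qed

text \<open>The Choquet integral sees only the survival function, so although \<open>c\<close> need
  not be additive the value is an ordinary expectation under this three-point law.\<close>

lemma choquet_integral_step_pos_part:
  fixes l b :: real
  assumes cap: "capacity M c" and S: "S \<in> sets M" and U: "U \<in> sets M" and "S \<subseteq> U"
    and l: "0 \<le> l" "l \<le> 1"
  shows "choquet_integral M c (\<lambda>\<omega>. max (l * indicator U \<omega> + (1 - l) * indicator S \<omega> - b) 0) =
    (1 - c U) * max (- b) 0 + (c U - c S) * max (l - b) 0 + c S * max (1 - b) 0"
proof -
  have pointwise: "indicat_real {0..} x *\<^sub>R
      c {\<omega>\<in>space M. l * indicator U \<omega> + (1 - l) * indicator S \<omega> > x + b} =
      (1 - c U) * indicat_real {0..<max (- b) 0} x + (c U - c S) * indicat_real {0..<max (l - b) 0} x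
      + c S * indicat_real {0..<max (1 - b) 0} x" for x
    unfolding capacity_step_greater[OF assms] by (auto simp: indicator_def)
  have "integrable lborel (indicat_real {0..<max r 0})"
    "integral\<^sup>L lborel (indicat_real {0..<max r 0}) = max r 0" for r
    by auto
  then show ?thesis
    unfolding choquet_integral_pos_part[OF cap] set_lebesgue_integral_def pointwise
    by (subst Bochner_Integration.integral_add; simp)+
qed

text \<open>A mean-preserving spread: moving the mass \<open>c U - c S\<close> from \<open>l\<close>
  to the endpoints 0 and 1 in proportions \<open>1 - l\<close> and \<open>l\<close> leaves mass
  exactly \<open>c A\<close> at 1. Convex stop-loss payoffs can only gain from this.\<close>

lemma stop_loss_le_step_indicator:
  assumes cap: "capacity M c" and A: "A \<in> sets M" and S: "S \<in> sets M" and U: "U \<in> sets M"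
    and "S \<subseteq> U" and l: "0 \<le> l" "l \<le> 1" and cA: "c A = l * c U + (1 - l) * c S"
  shows "stop_loss_le M c (\<lambda>\<omega>. l * indicator U \<omega> + (1 - l) * indicator S \<omega>) (indicator A)"
proof -
  \<comment> \<open>Convexity of the payoff \<open>max (x - b) 0\<close> at the point
    \<open>l\<close>, between 0 and 1.\<close>
  have conv: "0 \<le> (1 - l) * max (- b) 0 + l * max (1 - b) 0 - max (l - b) 0" for b
  proof -
    have "(1 - l) * max (- b) 0 \<ge> (1 - l) * (- b)" "l * max (1 - b) 0 \<ge> l * (1 - b)"
      "(1 - l) * max (- b) 0 \<ge> 0" "l * max (1 - b) 0 \<ge> 0"
      using l by (intro mult_left_mono mult_nonneg_nonneg; simp)+
    then show ?thesis by (auto simp: algebra_simps max_def)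
  qed
  have "0 \<le> (c U - c S) * ((1 - l) * max (- b) 0 + l * max (1 - b) 0 - max (l - b) 0)" for b
    using capacity_le[OF cap S U \<open>S \<subseteq> U\<close>] conv by (intro mult_nonneg_nonneg) auto
  then have "(1 - c U) * max (- b) 0 + (c U - c S) * max (l - b) 0 + c S * max (1 - b) 0
      \<le> (1 - c A) * max (- b) 0 + c A * max (1 - b) 0" for b
    unfolding cA by (simp add: algebra_simps)
  moreover have "choquet_integral M c (\<lambda>\<omega>. max (indicator A \<omega> - b) 0) =
      (1 - c A) * max (- b) 0 + c A * max (1 - b) 0" for b
    using choquet_integral_step_pos_part[OF cap A A order.refl, of 1 b] by simp
  ultimately show ?thesis
    unfolding stop_loss_le_def choquet_integral_step_pos_part[OF cap S U \<open>S \<subseteq> U\<close> l] by simp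
qed

section \<open>The representation\<close>

text \<open>The axioms are required at each \<omega> separately, so that with \<omega> fixed the
  argument concerns a real-valued functional.\<close>

locale comonotonic_risk_measure =
  fixes M :: "'a measure" and c :: "'a set \<Rightarrow> real" and \<rho> :: "('a \<Rightarrow> real) \<Rightarrow> 'a \<Rightarrow> real"
  assumes cap: "capacity M c"
    and stop_loss: "\<And>X Y \<omega>. X \<in> bdd_measurable M \<Longrightarrow> Y \<in> bdd_measurable M \<Longrightarrow>
        stop_loss_le M c X Y \<Longrightarrow> \<omega> \<in> space M \<Longrightarrow> \<rho> X \<omega> \<le> \<rho> Y \<omega>"
    and comon_add: "\<And>X Y \<omega>. X \<in> bdd_measurable M \<Longrightarrow> Y \<in> bdd_measurable M \<Longrightarrow>
        comonotonic M X Y \<Longrightarrow> \<omega> \<in> space M \<Longrightarrow> \<rho> (\<lambda>\<omega>. X \<omega> + Y \<omega>) \<omega> = \<rho> X \<omega> + \<rho> Y \<omega>"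
    and transl: "\<And>X a \<omega>. X \<in> bdd_measurable M \<Longrightarrow> \<omega> \<in> space M \<Longrightarrow>
        \<rho> (\<lambda>\<omega>. X \<omega> + a) \<omega> = \<rho> X \<omega> + a"
    and pos_hom: "\<And>X a \<omega>. X \<in> bdd_measurable M \<Longrightarrow> a \<ge> 0 \<Longrightarrow> \<omega> \<in> space M \<Longrightarrow>
        \<rho> (\<lambda>\<omega>. a * X \<omega>) \<omega> = a * \<rho> X \<omega>"
begin

section \<open>Monotonicity, normalisation and values on indicators\<close>

lemma bdd_indicator [simp]: "A \<in> sets M \<Longrightarrow> indicator A \<in> bdd_measurable M"
  by (rule bdd_measurableI[where K = 1]) (auto simp: indicator_def)

lemma bdd_scale: "X \<in> bdd_measurable M \<Longrightarrow> (\<lambda>\<omega>. a * X \<omega>) \<in> bdd_measurable M"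
  using bounded_scaling[of "X ` space M" a] by (auto simp: bdd_measurable_def image_image)

lemma bdd_const [simp]: "(\<lambda>_. a) \<in> bdd_measurable M"
  by (rule bdd_measurableI[where K = "\<bar>a\<bar>"]) auto

lemma survival_mono:
  assumes "X \<in> bdd_measurable M" "Y \<in> bdd_measurable M" "\<omega> \<in> space M"
    and "\<And>x. c {\<omega>\<in>space M. X \<omega> > x} \<le> c {\<omega>\<in>space M. Y \<omega> > x}"
  shows "\<rho> X \<omega> \<le> \<rho> Y \<omega>"
  by (intro stop_loss stop_loss_le_if_survival_le[OF cap] assms)

lemma mono:
  assumes X: "X \<in> bdd_measurable M" and Y: "Y \<in> bdd_measurable M" and "\<omega> \<in> space M"
    and le: "\<And>\<omega>. \<omega> \<in> space M \<Longrightarrow> X \<omega> \<le> Y \<omega>"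
  shows "\<rho> X \<omega> \<le> \<rho> Y \<omega>"
proof (rule survival_mono[OF X Y \<open>\<omega> \<in> space M\<close>])
  show "c {\<omega>\<in>space M. X \<omega> > x} \<le> c {\<omega>\<in>space M. Y \<omega> > x}" for x
    by (rule capacity_le[OF cap]) (use X Y le in \<open>force simp: bdd_measurable_def\<close>)+
qed

text \<open>Random variables are total functions, so \<rho> could a priori depend on values outside
  \<open>space M\<close>; monotonicity in both directions rules this out.\<close>

lemma cong:
  assumes "X \<in> bdd_measurable M" "Y \<in> bdd_measurable M" "\<omega> \<in> space M"
    and "\<And>\<omega>. \<omega> \<in> space M \<Longrightarrow> X \<omega> = Y \<omega>"
  shows "\<rho> X \<omega> = \<rho> Y \<omega>"
  by (intro antisym mono) (use assms in auto)

text \<open>Homogeneity with factor 0 gives value 0 at the zero function, and translation does the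
  rest.\<close>

lemma const: "\<omega> \<in> space M \<Longrightarrow> \<rho> (\<lambda>_. a) \<omega> = a"
  using pos_hom[of "\<lambda>_. 0" 0 \<omega>] transl[of "\<lambda>_. 0" \<omega> a] by simp

text \<open>The survival function of an indicator depends only on the capacity of its event, and
  increases with it. Events of equal capacity thus get equal values, which makes the distortion well
  defined.\<close>

lemma indicator_mono:
  assumes A: "A \<in> sets M" and B: "B \<in> sets M" and "c A \<le> c B" "\<omega> \<in> space M"
  shows "\<rho> (indicator A) \<omega> \<le> \<rho> (indicator B) \<omega>"
proof (rule survival_mono)
  \<comment> \<open>The step formula with \<open>S = U = E\<close> and \<open>l = 1\<close>: the
    middle mass disappears.\<close>
  have "c {\<omega>\<in>space M. indicat_real E \<omega> > x} =
      (1 - c E) * indicator {..<0} x + c E * indicator {..<1} x" if "E \<in> sets M" for E x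
    using capacity_step_greater[OF cap that that order.refl, of 1 x] by simp
  then show "c {\<omega>\<in>space M. indicat_real A \<omega> > x} \<le> c {\<omega>\<in>space M. indicat_real B \<omega> > x}" for x
    using assms by (auto simp: indicator_def)
qed (use assms in auto)

lemma indicator_concave:
  assumes A: "A \<in> sets M" and S: "S \<in> sets M" and U: "U \<in> sets M"
    and "S \<subseteq> U" and l: "0 \<le> l" "l \<le> 1" and cA: "c A = l * c U + (1 - l) * c S"
    and \<omega>: "\<omega> \<in> space M"
  shows "l * \<rho> (indicator U) \<omega> + (1 - l) * \<rho> (indicator S) \<omega> \<le> \<rho> (indicator A) \<omega>"
proof -
  let ?U = "\<lambda>\<omega>. l * indicator U \<omega>" and ?S = "\<lambda>\<omega>. (1 - l) * indicator S \<omega>"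
  \<comment> \<open>Indicators of nested events are comonotonic, and the weights are
    nonnegative.\<close>
  have "comonotonic M ?U ?S"
    using l \<open>S \<subseteq> U\<close> by (auto simp: comonotonic_def indicator_def)
  then have "\<rho> (\<lambda>\<omega>. ?U \<omega> + ?S \<omega>) \<omega> = \<rho> ?U \<omega> + \<rho> ?S \<omega>"
    using S U \<omega> by (intro comon_add bdd_scale) auto
  also have "\<dots> = l * \<rho> (indicator U) \<omega> + (1 - l) * \<rho> (indicator S) \<omega>"
    using S U \<omega> l by (simp add: pos_hom)
  finally have eq: "\<rho> (\<lambda>\<omega>. ?U \<omega> + ?S \<omega>) \<omega> = \<dots>" .
  have "(\<lambda>\<omega>. ?U \<omega> + ?S \<omega>) \<in> bdd_measurable M"
    by (rule bdd_measurableI[where K = 1]) (use S U l in \<open>auto simp: indicator_def\<close>)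
  from stop_loss[OF this bdd_indicator[OF A] _ \<omega>] show ?thesis
    unfolding eq using stop_loss_le_step_indicator[OF cap A S U \<open>S \<subseteq> U\<close> l cA] by simp
qed

section \<open>Layers of a random variable and the integral over its level sets\<close>

lemma bdd_min:
  assumes "X \<in> bdd_measurable M"
  shows "(\<lambda>\<omega>. min (X \<omega>) a) \<in> bdd_measurable M"
proof -
  from assms obtain K where "X \<in> borel_measurable M" "\<And>\<omega>. \<omega> \<in> space M \<Longrightarrow> \<bar>X \<omega>\<bar> < K"
    by (auto elim!: bdd_measurableE)
  then show ?thesis
    by (intro bdd_measurableI[where K = "K + \<bar>a\<bar>"]) fastforce+
qed

text \<open>The layer of \<open>X\<close> between \<open>a\<close> and \<open>b\<close> is a
  nondecreasing function of \<open>X\<close>, as is the truncation at \<open>a\<close>, so \<rho> is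
  additive on them. The layer itself lies between \<open>b - a\<close> times the indicators of
  \<open>X > b\<close> and of \<open>X > a\<close>.\<close>

lemma truncation_increment:
  assumes X: "X \<in> bdd_measurable M" and "a \<le> b" and \<omega>: "\<omega> \<in> space M"
  shows "\<rho> (\<lambda>\<omega>. min (X \<omega>) b) \<omega> - \<rho> (\<lambda>\<omega>. min (X \<omega>) a) \<omega>
      \<le> (b - a) * \<rho> (indicator {\<omega>\<in>space M. X \<omega> > a}) \<omega>"
    and "(b - a) * \<rho> (indicator {\<omega>\<in>space M. X \<omega> > b}) \<omega>
      \<le> \<rho> (\<lambda>\<omega>. min (X \<omega>) b) \<omega> - \<rho> (\<lambda>\<omega>. min (X \<omega>) a) \<omega>"
proof -
  let ?slice = "\<lambda>\<omega>. min (X \<omega>) b - min (X \<omega>) a"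
  have [measurable]: "X \<in> borel_measurable M" using X by (simp add: bdd_measurable_def)
  have slice: "?slice \<in> bdd_measurable M"
    by (rule bdd_measurableI[where K = "b - a"]) (use \<open>a \<le> b\<close> in \<open>auto simp: min_def\<close>)
  have level: "indicator {\<omega>\<in>space M. X \<omega> > x} \<in> bdd_measurable M" for x
    by simp
  have "comonotonic M (\<lambda>\<omega>. min (X \<omega>) a) ?slice"
    by (rule comonotonic_compose) (use \<open>a \<le> b\<close> in \<open>auto intro!: monoI simp: min_def\<close>)
  from comon_add[OF bdd_min[OF X] slice this \<omega>]
  have eq: "\<rho> (\<lambda>\<omega>. min (X \<omega>) b) \<omega> - \<rho> (\<lambda>\<omega>. min (X \<omega>) a) \<omega> = \<rho> ?slice \<omega>" by simp
  have "\<rho> ?slice \<omega> \<le> \<rho> (\<lambda>\<omega>. (b - a) * indicator {\<omega>\<in>space M. X \<omega> > a} \<omega>) \<omega>"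
    by (rule mono[OF slice bdd_scale[OF level] \<omega>])
      (use \<open>a \<le> b\<close> in \<open>auto simp: indicator_def min_def\<close>)
  then show "\<rho> (\<lambda>\<omega>. min (X \<omega>) b) \<omega> - \<rho> (\<lambda>\<omega>. min (X \<omega>) a) \<omega>
      \<le> (b - a) * \<rho> (indicator {\<omega>\<in>space M. X \<omega> > a}) \<omega>"
    using \<open>a \<le> b\<close> by (simp add: eq pos_hom[OF level _ \<omega>])
  have "\<rho> (\<lambda>\<omega>. (b - a) * indicator {\<omega>\<in>space M. X \<omega> > b} \<omega>) \<omega> \<le> \<rho> ?slice \<omega>"
    by (rule mono[OF bdd_scale[OF level] slice \<omega>])
      (use \<open>a \<le> b\<close> in \<open>auto simp: indicator_def min_def\<close>)
  then show "(b - a) * \<rho> (indicator {\<omega>\<in>space M. X \<omega> > b}) \<omega>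
      \<le> \<rho> (\<lambda>\<omega>. min (X \<omega>) b) \<omega> - \<rho> (\<lambda>\<omega>. min (X \<omega>) a) \<omega>"
    using \<open>a \<le> b\<close> by (simp add: eq pos_hom[OF level _ \<omega>])
qed

text \<open>With \<open>K\<close> bounding \<open>X\<close>, raising the truncation level from
  \<open>- K\<close> to \<open>K\<close> leads from the constant \<open>- K\<close> to
  \<open>X\<close> itself. The layer bounds turn the resulting increment of \<rho> into an integral
  of its values on level sets.\<close>

lemma eq_integral_level_sets:
  assumes X: "X \<in> bdd_measurable M" and \<omega>: "\<omega> \<in> space M"
  shows "\<rho> X \<omega> =
    (LBINT x:{0..}. \<rho> (indicator {\<omega>\<in>space M. X \<omega> > x}) \<omega>) +
    (LBINT x:{..0}. \<rho> (indicator {\<omega>\<in>space M. X \<omega> > x}) \<omega> - 1)"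
proof -
  define g where "g = (\<lambda>x. \<rho> (indicator {\<omega>\<in>space M. X \<omega> > x}) \<omega>)"
  define F where "F = (\<lambda>a. \<rho> (\<lambda>\<omega>. min (X \<omega>) a) \<omega>)"
  from X obtain K where meas [measurable]: "X \<in> borel_measurable M" and "K > 0"
    and K: "\<And>\<omega>. \<omega> \<in> space M \<Longrightarrow> \<bar>X \<omega>\<bar> < K"
    by (auto elim!: bdd_measurableE)
  have g: "antimono g"
    unfolding g_def
    by (intro antimonoI indicator_mono \<omega> antimonoD[OF capacity_greater_antimono[OF cap meas]])
      auto
  have hi: "g x = 0" if "x \<ge> K" for x
  proof -
    have "{\<omega>\<in>space M. X \<omega> > x} = {}" using K that by fastforce
    then have "g x = \<rho> (indicator {}) \<omega>" by (simp only: g_def)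
    also have "\<dots> = \<rho> (\<lambda>_. 0) \<omega>" by (rule cong) (use \<omega> in auto)
    finally show ?thesis using const[OF \<omega>] by simp
  qed
  have lo: "g x = 1" if "x < - K" for x
  proof -
    have "{\<omega>\<in>space M. X \<omega> > x} = space M" using K that by fastforce
    then have "g x = \<rho> (indicator (space M)) \<omega>" by (simp add: g_def)
    also have "\<dots> = \<rho> (\<lambda>_. 1) \<omega>" by (rule cong) (use \<omega> in auto)
    finally show ?thesis using const[OF \<omega>] by simp
  qed
  have "F K - F (- K) = (LBINT x:{-K..K}. g x)"
    by (rule increment_eq_set_integral[OF g])
      (use \<open>K > 0\<close> truncation_increment[OF X _ \<omega>] in \<open>auto simp: F_def g_def\<close>)
  moreover have "F K = \<rho> X \<omega>"
    unfolding F_def by (rule cong[OF bdd_min[OF X] X \<omega>]) (use K in fastforce)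
  moreover have "F (- K) = \<rho> (\<lambda>_. - K) \<omega>"
    unfolding F_def by (rule cong[OF bdd_min[OF X] bdd_const \<omega>]) (use K in fastforce)
  ultimately have "\<rho> X \<omega> = (LBINT x:{-K..K}. g x) - K"
    using const[OF \<omega>, of "- K"] by simp
  also have "\<dots> = (LBINT x:{0..}. g x) + (LBINT x:{..0}. g x - 1)"
    using set_integral_halflines_antimono[of g K, OF g _ hi lo] \<open>K > 0\<close> by simp
  finally show ?thesis by (simp add: g_def)
qed

end

text \<open>Provides one event for each \<open>t\<close>, from which the distortion can be defined;
  nestedness is what the concavity argument needs.\<close>

lemma ex_chain_of_all_capacities:
  fixes Z :: "'a \<Rightarrow> real"
  assumes cap: "capacity M c" and Z: "Z \<in> borel_measurable M"
    and cont: "continuous_on UNIV (distr_fun M c Z)"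
    and bot: "(distr_fun M c Z \<longlongrightarrow> 0) at_bot" and top: "(distr_fun M c Z \<longlongrightarrow> 1) at_top"
  obtains A where "\<And>t. t \<in> {0..1} \<Longrightarrow> A t \<in> sets M" "\<And>t. t \<in> {0..1} \<Longrightarrow> c (A t) = t"
    "\<And>s t. s \<in> {0..1} \<Longrightarrow> t \<in> {0..1} \<Longrightarrow> s \<le> t \<Longrightarrow> A s \<subseteq> A t"
proof -
  let ?L = "\<lambda>z. {\<omega>\<in>space M. Z \<omega> > z}"
  have "\<exists>z. c (?L z) = t" if t: "0 < t" "t < 1" for t
  proof -
    have "\<forall>\<^sub>F z in at_bot. distr_fun M c Z z < 1 - t" "\<forall>\<^sub>F z in at_top. 1 - t < distr_fun M c Z z"
      using order_tendstoD[OF bot] order_tendstoD[OF top] t by auto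
    then obtain p q where pq: "\<And>z. z \<le> p \<Longrightarrow> distr_fun M c Z z < 1 - t"
      "\<And>z. z \<ge> q \<Longrightarrow> 1 - t < distr_fun M c Z z"
      by (auto simp: eventually_at_bot_linorder eventually_at_top_linorder)
    \<comment> \<open>The points \<open>p\<close> and \<open>q\<close> come in no known order;
      starting at \<open>min p q\<close> gives a genuine interval for the intermediate value
      theorem.\<close>
    have "\<exists>z\<ge>min p q. z \<le> q \<and> distr_fun M c Z z = 1 - t"
      by (rule IVT') (use pq[of "min p q"] pq(2)[of q] cont in
        \<open>auto intro: continuous_on_subset less_imp_le\<close>)
    then show ?thesis by (auto simp: distr_fun_def)
  qed
  then obtain z where z: "\<And>t. 0 < t \<Longrightarrow> t < 1 \<Longrightarrow> c (?L (z t)) = t" by metis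
  \<comment> \<open>The limits 0 and 1 of the distribution function need not be attained, so the
    extreme capacities are realised by the empty set and the whole space.\<close>
  define A where "A = (\<lambda>t. if t \<le> 0 then {} else if t \<ge> 1 then space M else ?L (z t))"
  show ?thesis
  proof
    show "A t \<in> sets M" for t using Z by (simp add: A_def)
    show cA: "c (A t) = t" if "t \<in> {0..1}" for t
      using that z[of t] cap by (auto simp: A_def capacity_def)
    show "A s \<subseteq> A t" if "s \<in> {0..1}" "t \<in> {0..1}" "s \<le> t" for s t
    proof (cases "0 < s \<and> t < 1 \<and> s < t")
      case True
      \<comment> \<open>The levels were chosen arbitrarily, but the survival function of
        \<open>Z\<close> is antitone, so a strictly larger capacity forces a level that is no
        higher.\<close>
      have "z t \<le> z s"
      proof (rule ccontr)
        assume "\<not> z t \<le> z s"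
        then have "c (?L (z t)) \<le> c (?L (z s))"
          using antimonoD[OF capacity_greater_antimono[OF cap Z], of "z s" "z t"] by simp
        then show False using z[of s] z[of t] True by simp
      qed
      then show ?thesis using True by (auto simp: A_def)
    next
      case False
      then show ?thesis using that by (auto simp: A_def)
    qed
  qed
qed

theorem theorem3:
  fixes M G :: "'a measure"
    and c :: "'a set \<Rightarrow> real"
    and \<rho> :: "('a \<Rightarrow> real) \<Rightarrow> ('a \<Rightarrow> real)"
  assumes subalg: "subalgebra M G"
    and cap: "capacity M c"
    and cont_below: "continuous_from_below M c"
    and ex_Z: "\<exists>Z \<in> borel_measurable M.
        continuous_on UNIV (distr_fun M c Z) \<and>
        (distr_fun M c Z \<longlongrightarrow> 0) at_bot \<and> (distr_fun M c Z \<longlongrightarrow> 1) at_top"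
    and rho: "\<rho> \<in> bdd_measurable M \<rightarrow> bdd_measurable G"
    and stop_loss: "\<And>X Y. X \<in> bdd_measurable M \<Longrightarrow> Y \<in> bdd_measurable M \<Longrightarrow>
        stop_loss_le M c X Y \<Longrightarrow> \<forall>\<omega>\<in>space M. \<rho> X \<omega> \<le> \<rho> Y \<omega>"
    and comon_add: "\<And>X Y. X \<in> bdd_measurable M \<Longrightarrow> Y \<in> bdd_measurable M \<Longrightarrow>
        comonotonic M X Y \<Longrightarrow> \<forall>\<omega>\<in>space M. \<rho> (\<lambda>\<omega>. X \<omega> + Y \<omega>) \<omega> = \<rho> X \<omega> + \<rho> Y \<omega>"
    and transl: "\<And>X a. X \<in> bdd_measurable M \<Longrightarrow>
        \<forall>\<omega>\<in>space M. \<rho> (\<lambda>\<omega>. X \<omega> + a) \<omega> = \<rho> X \<omega> + a"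
    and pos_hom: "\<And>X a. X \<in> bdd_measurable M \<Longrightarrow> a \<ge> 0 \<Longrightarrow>
        \<forall>\<omega>\<in>space M. \<rho> (\<lambda>\<omega>. a * X \<omega>) \<omega> = a * \<rho> X \<omega>"
  shows "\<exists>\<phi>. concave_random_distortion G \<phi> \<and>
      (\<forall>X\<in>bdd_measurable M. \<forall>\<omega>\<in>space M. \<rho> X \<omega> = distorted_choquet_integral M \<phi> c X \<omega>)"
proof -
  interpret comonotonic_risk_measure M c \<rho>
    by unfold_locales (use cap stop_loss comon_add transl pos_hom in blast)+
  have G: "space G = space M" using subalg by (simp add: subalgebra_def)
  from ex_Z cap obtain A where A: "\<And>t. t \<in> {0..1} \<Longrightarrow> A t \<in> sets M"
    and cA: "\<And>t. t \<in> {0..1} \<Longrightarrow> c (A t) = t"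
    and A_mono: "\<And>s t. s \<in> {0..1} \<Longrightarrow> t \<in> {0..1} \<Longrightarrow> s \<le> t \<Longrightarrow> A s \<subseteq> A t"
    by (metis ex_chain_of_all_capacities)
  \<comment> \<open>For fixed \<open>t\<close> this is \<rho> of one fixed random variable, so
    measurability in \<omega> with respect to \<open>G\<close> is inherited from \<rho>.\<close>
  define \<phi> where "\<phi> = (\<lambda>\<omega> t. \<rho> (indicator (A t)) \<omega>)"
  \<comment> \<open>\<open>E\<close> and \<open>A (c E)\<close> have the same capacity, so the
    choice of chain does not matter.\<close>
  have \<phi>_capacity: "\<phi> \<omega> (c E) = \<rho> (indicator E) \<omega>" if "E \<in> sets M" "\<omega> \<in> space M" for E \<omega>
  proof -
    have "c E \<in> {0..1}" using capacity_bounds[OF cap that(1)] by simp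
    then show ?thesis
      unfolding \<phi>_def by (intro antisym indicator_mono) (use A cA that in auto)
  qed
  have \<phi>_mono: "\<phi> \<omega> s \<le> \<phi> \<omega> t" if "s \<in> {0..1}" "t \<in> {0..1}" "s \<le> t" "\<omega> \<in> space M" for s t \<omega>
    unfolding \<phi>_def by (rule indicator_mono) (use A cA that in auto)
  have \<phi>_0: "\<phi> \<omega> 0 = 0" if "\<omega> \<in> space M" for \<omega>
    using \<phi>_capacity[of "{}" \<omega>] const[OF that, of 0] cap that
    by (simp add: capacity_def indicator_def[abs_def])
  have \<phi>_1: "\<phi> \<omega> 1 = 1" if "\<omega> \<in> space M" for \<omega>
  proof -
    have "\<rho> (indicator (space M)) \<omega> = \<rho> (\<lambda>_. 1) \<omega>" by (rule cong) (use that in auto)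
    then show ?thesis
      using \<phi>_capacity[of "space M" \<omega>] const[OF that, of 1] cap that by (simp add: capacity_def)
  qed
  have "concave_on {0..1} (\<phi> \<omega>)" if \<omega>: "\<omega> \<in> space M" for \<omega>
  proof (rule concave_on_linorderI)
    fix l s u :: real
    assume l: "0 < l" "l < 1" and su: "s \<in> {0..1}" "u \<in> {0..1}" "s < u"
    have t: "(1 - l) * s + l * u \<in> {0..1}"
      using convexD_alt[OF convex_real_interval(5) su(1,2), of l] l by simp
    show "\<phi> \<omega> ((1 - l) *\<^sub>R s + l *\<^sub>R u) \<ge> (1 - l) * \<phi> \<omega> s + l * \<phi> \<omega> u"
      \<comment> \<open>The inner event is \<open>A s\<close>, the outer one \<open>A u\<close>, and
        the event of intermediate capacity comes from the same chain.\<close>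
      using indicator_concave[OF A[OF t] A[OF su(1)] A[OF su(2)] A_mono[OF su(1,2)], of l \<omega>]
        l su \<omega> by (simp add: cA[OF t] cA[OF su(1)] cA[OF su(2)] \<phi>_def)
  qed simp
  moreover have "random_distortion G \<phi>"
    unfolding random_distortion_def
  proof (intro conjI ballI)
    fix \<omega> assume "\<omega> \<in> space G"
    then have \<omega>: "\<omega> \<in> space M" by (simp add: G)
    show "\<phi> \<omega> \<in> {0..1} \<rightarrow> {0..1}"
      using \<phi>_mono[OF _ _ _ \<omega>, of 0] \<phi>_mono[OF _ _ _ \<omega>, of _ 1] \<phi>_0[OF \<omega>] \<phi>_1[OF \<omega>] by fastforce
    show "mono_on {0..1} (\<phi> \<omega>)" by (rule mono_onI) (rule \<phi>_mono[OF _ _ _ \<omega>])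
    show "\<phi> \<omega> 0 = 0" "\<phi> \<omega> 1 = 1" using \<phi>_0[OF \<omega>] \<phi>_1[OF \<omega>] by auto
  next
    fix t :: real assume "t \<in> {0..1}"
    then have "\<rho> (indicator (A t)) \<in> bdd_measurable G" using rho A by auto
    then show "(\<lambda>\<omega>. \<phi> \<omega> t) \<in> borel_measurable G" by (simp add: \<phi>_def bdd_measurable_def)
  qed
  moreover have "\<rho> X \<omega> = distorted_choquet_integral M \<phi> c X \<omega>"
    if X: "X \<in> bdd_measurable M" and \<omega>: "\<omega> \<in> space M" for X \<omega>
  proof -
    have [measurable]: "X \<in> borel_measurable M" using X by (simp add: bdd_measurable_def)
    show ?thesis
      \<comment> \<open>The two integral formulas now agree integrand by integrand, since
        \<open>\<phi> \<omega>\<close> of the capacity of a level set is \<rho> of its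
        indicator.\<close>
      unfolding eq_integral_level_sets[OF X \<omega>] distorted_choquet_integral_def
      by (simp add: \<phi>_capacity[OF _ \<omega>])
  qed
  ultimately show ?thesis
    unfolding concave_random_distortion_def G by blast
qed

end
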